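(* Let $n,k\geq 1$ with $\gcd(2^{2k}-2^k+1,2^n-1)=1$, and write $d=2^{2k}-2^k+1$. Let $r$ be the least positive residue of $n$ modulo $6k$. Then the following hold. (a) $$\mathrm{Inv}_d(n) = \mathrm{Inv}_d(r)\cdot 2^{n-r} + \left(\frac{(2^{2k}-2^k+1)\cdot\mathrm{Inv}_d(r)-1}{2^r-1}-1\right)\frac{2^{n-r}-1}{2^{2k}-2^k+1}.$$ (b) Let $\boldsymbol{g_n}$ be the binary sequence of length $n$ representing $\mathrm{Inv}_d(n)$; let $\boldsymbol{w_{3k}}$ be the binary sequence of length $3k$ representing $$\left(\frac{(2^{2k}-2^k+1)\cdot\mathrm{Inv}_d(r)-1}{2^r-1}-1\right)\cdot(2^k+1)-1;$$ and let $\boldsymbol{a_r}$ be the binary sequence of length $r$ representing $\mathrm{Inv}_d(r)$. Then $\boldsymbol{g_n}$ is obtained by concatenating the sequences $\boldsymbol{a_r}$, $\boldsymbol{w_{3k}}$ and $\boldsymbol{\bar w_{3k}}$ as follows: $$\boldsymbol{g_n}=\boldsymbol{a_r}\,|\,\boldsymbol{w_{3k}}\,|\,\boldsymbol{\bar w_{3k}}\,|\,\ldots\,|\,\boldsymbol{w_{3k}}\,|\,\boldsymbol{\bar w_{3k}},$$ where the block $\boldsymbol{w_{3k}}\,|\,\boldsymbol{\bar w_{3k}}$ occurs $\frac{n-r}{6k}$ times. In particular, $\mathrm{wt}(\boldsymbol{g_n})=\mathrm{wt}(\boldsymbol{a_r})+\frac{n-r}{2}$.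
   Context: For a positive integer $d$ and $n\ge 1$ with $\gcd(d,2^n-1)=1$, $\mathrm{Inv}_d(n)$ denotes the least positive residue of the inverse of $d$ modulo $2^n-1$, i.e. the smallest positive integer $t$ with $d\cdot t\equiv 1 \pmod{2^n-1}$; thus $0<\mathrm{Inv}_d(n)<2^n-1$ for $n\ge 2$, and $\mathrm{Inv}_d(1)=1$. The binary sequence of length $\ell$ representing an integer $0\le v<2^\ell$ is $v_{\ell-1}\ldots v_1v_0$ with $v=\sum_{i=0}^{\ell-1}v_i2^i$, $v_i\in\{0,1\}$ (most significant bit first, padded with leading zeros). The complementary sequence $\boldsymbol{\bar a}$ of a binary sequence $\boldsymbol{a}$ is obtained by flipping every bit. $\boldsymbol{a}\,|\,\boldsymbol{b}$ denotes concatenation. The binary weight $\mathrm{wt}$ of a sequence is the number of ones in it. *)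

theory Defs
  imports Complex_Main "HOL-Number_Theory.Cong"
begin

definition Inv :: "nat \<Rightarrow> nat \<Rightarrow> nat" where
  "Inv d n = (LEAST t. 0 < t \<and> [d * t = 1] (mod (2 ^ n - 1)))"

text \<open>The representative lies in \<open>{1..m}\<close>: multiples of \<open>m\<close> have residue \<open>m\<close>, not \<open>0\<close>.\<close>

definition least_pos_residue :: "nat \<Rightarrow> nat \<Rightarrow> nat" where
  "least_pos_residue n m = (LEAST t. 0 < t \<and> [t = n] (mod m))"

text \<open>Most significant bit first, padded with leading zeros; \<open>True\<close> stands for the digit 1.
  Meaningful only for \<open>v < 2 ^ l\<close>; otherwise the high bits are dropped.\<close>

definition binseq :: "nat \<Rightarrow> nat \<Rightarrow> bool list" where
  "binseq l v = map (bit v) (rev [0..<l])"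

definition complement :: "bool list \<Rightarrow> bool list" where
  "complement a = map Not a"

definition wt :: "bool list \<Rightarrow> nat" where
  "wt a = count_list a True"

lemma Inv_props:
  assumes "1 \<le> n" and "coprime d (2 ^ n - 1)"
  shows "0 < Inv d n" "[d * Inv d n = 1] (mod (2 ^ n - 1))" "Inv d n < 2 ^ n"
proof -
  let ?m = "2 ^ n - 1 :: nat"
  let ?P = "\<lambda>t. 0 < t \<and> [d * t = 1] (mod ?m)"
  have "(2::nat) ^ 1 \<le> 2 ^ n" using assms(1) by (intro power_increasing) auto
  then have m: "0 < ?m" by simp
  obtain x where x: "[d * x = 1] (mod ?m)"
    using cong_solve_coprime_nat[OF assms(2)] by auto
  define t where "t = (if x mod ?m = 0 then ?m else x mod ?m)"
  have "[t = x] (mod ?m)" by (auto simp: t_def cong_def)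
  then have "[d * t = 1] (mod ?m)"
    using x by (meson cong_scalar_left cong_trans)
  moreover have "0 < t" "t \<le> ?m"
    using m by (auto simp: t_def intro: less_imp_le)
  ultimately have t: "?P t" "t \<le> ?m" by auto
  have "?P (Inv d n)" unfolding Inv_def by (rule LeastI[of ?P, OF t(1)])
  then show "0 < Inv d n" "[d * Inv d n = 1] (mod ?m)" by auto
  have "Inv d n \<le> t" unfolding Inv_def by (rule Least_le[of ?P, OF t(1)])
  with t(2) m show "Inv d n < 2 ^ n" by linarith
qed

lemma least_pos_residue_props:
  assumes "0 < n" and "0 < m"
  shows "0 < least_pos_residue n m" "least_pos_residue n m \<le> m"
    "least_pos_residue n m \<le> n" "m dvd n - least_pos_residue n m"
proof -
  let ?P = "\<lambda>t. 0 < t \<and> [t = n] (mod m)"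
  let ?r = "least_pos_residue n m"
  define t where "t = (if n mod m = 0 then m else n mod m)"
  have t: "?P t" "t \<le> m"
    using assms by (auto simp: t_def cong_def intro: less_imp_le)
  have r: "?P ?r" unfolding least_pos_residue_def by (rule LeastI[of ?P, OF t(1)])
  then show "0 < ?r" by simp
  have "?r \<le> t" unfolding least_pos_residue_def by (rule Least_le[of ?P, OF t(1)])
  with t(2) show "?r \<le> m" by simp
  show le: "?r \<le> n" unfolding least_pos_residue_def
    using assms by (intro Least_le) auto
  show "m dvd n - ?r"
    using r le by (metis cong_altdef_nat cong_sym)
qed

lemma length_binseq: "length (binseq l v) = l"
  by (simp add: binseq_def)

lemma binseq_represents:
  assumes "v < 2 ^ l"
  shows "v = (\<Sum>i<l. of_bool (binseq l v ! (l - 1 - i)) * 2 ^ i)"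
proof -
  have "binseq l v ! (l - 1 - i) = bit v i" if "i < l" for i
    using that by (simp add: binseq_def rev_nth)
  then have "(\<Sum>i<l. of_bool (binseq l v ! (l - 1 - i)) * 2 ^ i)
      = (\<Sum>i = 0..<l. of_bool (bit v i) * (2::nat) ^ i)"
    by (simp add: atLeast0LessThan)
  also have "\<dots> = horner_sum of_bool 2 (map (bit v) [0..<l])"
    by (simp add: horner_sum_eq_sum atLeast0LessThan)
  also have "\<dots> = take_bit l v"
    by (simp add: horner_sum_bit_eq_take_bit)
  also have "\<dots> = v"
    using assms by (simp add: take_bit_nat_eq_self)
  finally show ?thesis by simp
qed

end

theory Submission
  imports Defs
begin

text \<open>
  The inverse \<open>t\<close> of \<open>d\<close> modulo \<open>2 ^ n - 1\<close> is determined by its quotient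
  \<open>c = (d * t - 1) / (2 ^ n - 1)\<close>: the equation \<open>d * t = c * (2 ^ n - 1) + 1\<close> with \<open>c < d\<close> forces
  \<open>t\<close> to be the least positive representative (lemma \<open>Inv_eqI\<close>).  If \<open>d\<close> divides \<open>2 ^ l - 1\<close>, then
  replacing \<open>n\<close> by \<open>n + l\<close> leaves \<open>c\<close> unchanged, because
  \<open>d * (t * 2 ^ l + (c - 1) * ((2 ^ l - 1) / d)) = c * (2 ^ (n + l) - 1) + 1\<close>.  This is part (a):
  here \<open>d * (2 ^ k + 1) = 2 ^ (3 * k) + 1\<close>, so \<open>d\<close> divides \<open>2 ^ (6 * k) - 1\<close>, and \<open>n - r\<close> is a
  multiple of \<open>6 * k\<close>.

  For part (b), put \<open>v + 1 = (c - 1) * (2 ^ k + 1)\<close>.  The summand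
  \<open>(c - 1) * ((2 ^ (n - r) - 1) / d)\<close> equals \<open>(v + 1) * (2 ^ (3 * k) - 1)\<close> times the geometric sum
  \<open>1 + 2 ^ (6 * k) + \<dots>\<close>, so its binary expansion repeats the digits of
  \<open>(v + 1) * (2 ^ (3 * k) - 1) = v * 2 ^ (3 * k) + (2 ^ (3 * k) - 1 - v)\<close>, which are those of \<open>v\<close>
  followed by their complement.  The bounds \<open>2 \<le> c < d\<close> give \<open>0 \<le> v < 2 ^ (3 * k)\<close>; the lower one
  holds because an odd \<open>d > 1\<close> divides neither \<open>1\<close> (\<open>c = 0\<close>) nor \<open>2 ^ r\<close> (\<open>c = 1\<close>).
\<close>

text \<open>The bound \<open>c < d\<close> puts \<open>t\<close> into \<open>{1..2 ^ n - 1}\<close>, a complete residue system, so \<open>t\<close> is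
  the only inverse there.  The terms of \<open>d * t = c * (2 ^ n - 1) + 1\<close> are arranged so as to avoid
  truncated subtraction.\<close>

lemma Inv_eqI:
  fixes c d n t :: nat
  assumes n: "1 \<le> n" and eq: "d * t + c = c * 2 ^ n + 1" and c: "c < d"
  shows "Inv d n = t"
proof -
  define M where "M = (2::nat) ^ n - 1"
  have "(2::nat) ^ 1 \<le> 2 ^ n" using n by (intro power_increasing) auto
  then have M: "0 < M" "2 ^ n = M + 1" by (auto simp: M_def)
  have dt: "d * t = c * M + 1" using eq unfolding M(2) by (simp add: algebra_simps)
  then have t0: "0 < t" by (cases t) auto
  have inv: "[d * t = 1] (mod M)" unfolding dt cong_def by (metis add.commute mod_mult_self1)
  have cop: "coprime d M"
    using inv coprime_iff_invertible_nat[of d M] by auto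
  have "d * t \<le> d * M"
    using mult_right_mono[of "c + 1" d M] c M(1) dt by simp
  then have "t \<le> M" using c by simp
  have props: "0 < Inv d n" "[d * Inv d n = 1] (mod M)"
    using Inv_props(1,2)[OF n, of d] cop by (auto simp: M_def)
  have "Inv d n \<le> t"
    unfolding Inv_def using t0 inv by (intro Least_le) (auto simp: M_def)
  have "[d * t = d * Inv d n] (mod M)" using inv props(2) by (meson cong_sym cong_trans)
  then have "[t = Inv d n] (mod M)" using cop by (simp add: cong_mult_lcancel_nat)
  then have "M dvd t - Inv d n"
    using \<open>Inv d n \<le> t\<close> by (simp add: cong_altdef_nat)
  moreover have "t - Inv d n < M" using \<open>t \<le> M\<close> props(1) t0 by linarith
  ultimately show ?thesis using \<open>Inv d n \<le> t\<close> by (auto dest: dvd_imp_le)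
qed

lemma Inv_quotient:
  fixes d n :: nat
  assumes n: "1 \<le> n" and cop: "coprime d (2 ^ n - 1)" and d: "1 < d" "odd d"
  obtains c where "d * Inv d n + c = c * 2 ^ n + 1" "2 \<le> c" "c < d"
proof -
  define M where "M = (2::nat) ^ n - 1"
  have "(2::nat) ^ 1 \<le> 2 ^ n" using n by (intro power_increasing) auto
  then have M: "0 < M" "2 ^ n = M + 1" by (auto simp: M_def)
  define t where "t = Inv d n"
  have t: "0 < t" "[d * t = 1] (mod M)" "t \<le> M"
    using Inv_props[OF n cop] unfolding t_def[symmetric] M_def[symmetric] M(2) by auto
  have "M dvd d * t - 1"
    using t(1,2) d by (subst (asm) cong_altdef_nat) auto
  then obtain c where c: "d * t - 1 = M * c" by (auto simp: dvd_def)
  moreover have "0 < d * t" using t(1) d by simp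
  ultimately have dt: "d * t = c * M + 1" using mult.commute[of c M] by linarith
  have eq: "d * t + c = c * 2 ^ n + 1" unfolding dt M(2) by (simp add: algebra_simps)
  have "c * M < d * M"
    using dt mult_le_mono2[OF t(3), of d] by linarith
  then have "c < d" by simp
  moreover have "c \<noteq> 0"
  proof
    assume "c = 0"
    then have "d * t = 1" using dt by simp
    then show False using d(1) by simp
  qed
  moreover have "c \<noteq> 1"
  proof
    assume "c = 1"
    then have "d dvd 2 ^ n" using eq by (auto intro: dvdI[of _ _ t])
    moreover have "coprime d (2 ^ n)" using d by (simp add: coprime_commute)
    ultimately show False using d by (auto dest: coprime_absorb_left)
  qed
  ultimately show thesis using that[of c] eq unfolding t_def by linarith
qed

text \<open>The right-hand side satisfies the equation that characterises \<open>Inv d (n + l)\<close>, with the same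
  quotient \<open>c\<close>; this invariance is what makes the digits periodic.\<close>

lemma Inv_add:
  fixes c d e l n :: nat
  assumes n: "1 \<le> n" and eq: "d * Inv d n + c = c * 2 ^ n + 1"
    and c: "1 \<le> c" "c < d" and e: "d * e + 1 = 2 ^ l"
  shows "Inv d (n + l) = Inv d n * 2 ^ l + (c - 1) * e"
proof (rule Inv_eqI[where c = c])
  obtain b where b: "c = b + 1" using c by (metis le_add_diff_inverse2)
  have "d * (Inv d n * 2 ^ l + (c - 1) * e) + c
      = d * Inv d n * 2 ^ l + b * (d * e + 1) + 1"
    by (simp add: b algebra_simps)
  also have "\<dots> = (d * Inv d n + c) * 2 ^ l - 2 ^ l + 1"
    unfolding e by (simp add: b algebra_simps)
  also have "\<dots> = c * 2 ^ (n + l) + 1"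
    unfolding eq by (simp add: power_add algebra_simps)
  finally show "d * (Inv d n * 2 ^ l + (c - 1) * e) + c = c * 2 ^ (n + l) + 1" .
qed (use n c in auto)

lemma coprime_Mersenne_add:
  fixes d e l n :: nat
  assumes "coprime d (2 ^ (n + l) - 1)" and e: "d * e + 1 = 2 ^ l"
  shows "coprime d (2 ^ n - 1)"
proof -
  have "2 ^ (n + l) - 1 = (e * 2 ^ n) * d + (2 ^ n - 1)"
    by (simp add: power_add e[symmetric] algebra_simps)
  then have "gcd d (2 ^ (n + l) - 1) = gcd d (2 ^ n - 1)"
    by (simp only: gcd_add_mult)
  then show ?thesis
    using assms(1) by (simp only: coprime_iff_gcd_eq_1)
qed

lemma binseq_append:
  assumes "b < 2 ^ l"
  shows "binseq (m + l) (a * 2 ^ l + b) = binseq m a @ binseq l b"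
proof -
  have high: "bit (a * 2 ^ l + b) (l + i) = bit a i" for i
    using assms by (simp add: bit_iff_odd power_add div_mult2_eq)
  have low: "bit (a * 2 ^ l + b) i = bit b i" if "i < l" for i
  proof -
    have "take_bit l (a * 2 ^ l + b) = b" using assms by (simp add: take_bit_eq_mod)
    then show ?thesis using that by (metis bit_take_bit_iff)
  qed
  have "[0..<m + l] = [0..<l] @ map (\<lambda>i. l + i) [0..<m]"
    using upt_add_eq_append[of 0 l m] map_add_upt[of l m] by (simp add: add.commute)
  then show ?thesis
    by (simp add: binseq_def rev_map high low del: map_add_upt)
qed

lemma binseq_complement:
  assumes "v < 2 ^ l"
  shows "binseq l (2 ^ l - 1 - v) = complement (binseq l v)"
proof -
  have "bit (2 ^ l - 1 - v) i \<longleftrightarrow> \<not> bit v i" if "i < l" for i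
  proof -
    have "int (2 ^ l - 1 - v) = mask l - take_bit l (int v)"
      using assms by (simp add: mask_eq_exp_minus_1 of_nat_diff take_bit_int_eq_self)
    also have "\<dots> = take_bit l (not (int v))"
      by (rule take_bit_not_eq_mask_diff[symmetric])
    finally show ?thesis
      using that by (metis bit_not_int_iff bit_of_nat_iff_bit bit_take_bit_iff)
  qed
  then show ?thesis by (simp add: binseq_def complement_def)
qed

text \<open>The size bound belongs to the induction: without it the leading copy of \<open>b\<close> could receive a
  carry from the lower ones.\<close>

lemma binseq_geometric_sum:
  assumes "b < 2 ^ l"
  shows "b * (\<Sum>j<q. (2 ^ l) ^ j) < 2 ^ (l * q)
    \<and> binseq (l * q) (b * (\<Sum>j<q. (2 ^ l) ^ j)) = concat (replicate q (binseq l b))"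
proof (induction q)
  case 0
  then show ?case by (simp add: binseq_def)
next
  case (Suc q)
  define s where "s = b * (\<Sum>j<q. (2 ^ l) ^ j)"
  have s: "b * (\<Sum>j<Suc q. (2 ^ l) ^ j) = b * 2 ^ (l * q) + s"
    by (simp add: s_def power_mult algebra_simps)
  have IH: "s < 2 ^ (l * q)" "binseq (l * q) s = concat (replicate q (binseq l b))"
    using Suc by (auto simp: s_def)
  have "b * 2 ^ (l * q) + s < (b + 1) * 2 ^ (l * q)" using IH(1) by simp
  also have "\<dots> \<le> 2 ^ l * 2 ^ (l * q)" using assms by (intro mult_right_mono) auto
  finally show ?case
    unfolding s using binseq_append[OF IH(1), of l b] IH(2) by (simp add: power_add)
qed

lemma wt_append: "wt (a @ b) = wt a + wt b"
  by (simp add: wt_def)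

lemma wt_concat_replicate: "wt (concat (replicate q a)) = q * wt a"
  by (induction q) (auto simp: wt_append, simp add: wt_def)

lemma wt_complement: "wt a + wt (complement a) = length a"
  by (induction a) (auto simp: wt_def complement_def)

theorem theorem3p12:
  fixes n k d r :: nat
  assumes "1 \<le> n" and "1 \<le> k"
    and "d = 2 ^ (2 * k) - 2 ^ k + 1"
    and "coprime d (2 ^ n - 1)"
    and "r = least_pos_residue n (6 * k)"
  shows "coprime d (2 ^ r - 1)
    \<and> real (Inv d n) = real (Inv d r) * 2 ^ (n - r)
        + ((real d * real (Inv d r) - 1) / (2 ^ r - 1) - 1) * ((2 ^ (n - r) - 1) / real d)
    \<and> (\<exists>v::nat.
        real v = ((real d * real (Inv d r) - 1) / (2 ^ r - 1) - 1) * (2 ^ k + 1) - 1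
        \<and> v < 2 ^ (3 * k)
        \<and> binseq n (Inv d n) = binseq r (Inv d r)
            @ concat (replicate ((n - r) div (6 * k))
                (binseq (3 * k) v @ complement (binseq (3 * k) v))))
    \<and> real (wt (binseq n (Inv d n))) = real (wt (binseq r (Inv d r))) + (real n - real r) / 2"
proof -
  define l where "l = 3 * k"
  have r: "0 < r" "r \<le> n" "6 * k dvd n - r"
    using least_pos_residue_props[of n "6 * k"] assms(1,2,5) by auto
  then obtain q where q: "n - r = 6 * k * q" by (auto simp: dvd_def)
  then have n: "n = r + l * 2 * q" using r(2) by (simp add: l_def)

  define K where "K = (2::nat) ^ k"
  have "(2::nat) ^ 1 \<le> 2 ^ k" using assms(2) by (intro power_increasing) auto
  then have K: "2 \<le> K" by (simp add: K_def)
  \<comment> \<open>Writing everything in \<open>j\<close> removes the truncated subtraction from \<open>d\<close>.\<close>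
  define j where "j = K - 2"
  have Kj: "K = j + 2" using K by (simp add: j_def)
  have dK: "d = K * K - K + 1"
    unfolding assms(3) K_def by (simp add: mult_2 power_add)
  have dj: "d = j * j + 3 * j + 3" unfolding dK Kj by (simp add: algebra_simps)
  have L: "2 ^ l = K * K * K"
    unfolding l_def K_def by (simp add: mult.commute[of 3] power_mult power3_eq_cube)
  have dK1: "d * (K + 1) = 2 ^ l + 1"
    unfolding L dj Kj by (simp add: algebra_simps)
  have "1 < d" by (simp add: dj)
  moreover have "odd d" using assms(2) unfolding dK K_def by simp
  ultimately have d: "1 < d" "odd d" .

  define S where "S = (\<Sum>i<q. ((2::nat) ^ (l * 2)) ^ i)"
  \<comment> \<open>The cofactor of \<open>d\<close> in \<open>2 ^ (n - r) - 1\<close>, from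
    \<open>2 ^ (n - r) - 1 = (2 ^ l + 1) * (2 ^ l - 1) * S\<close> and \<open>2 ^ l + 1 = d * (K + 1)\<close>.\<close>
  define e where "e = (K + 1) * (2 ^ l - 1) * S"
  have "(2 ^ l + 1) * (2 ^ l - 1) + 1 = (2::nat) ^ (l * 2)"
  proof -
    obtain x where "(2::nat) ^ l = x + 1"
      by (metis Suc_eq_plus1 gr0_implies_Suc zero_less_numeral zero_less_power)
    then show ?thesis by (simp add: power_mult power2_eq_square algebra_simps)
  qed
  moreover have "(2 ^ (l * 2) - 1) * S + 1 = (2::nat) ^ (l * 2 * q)"
  proof -
    obtain x where x: "(2::nat) ^ (l * 2) = x + 1"
      by (metis Suc_eq_plus1 gr0_implies_Suc zero_less_numeral zero_less_power)
    have "x * (\<Sum>i<p. (x + 1) ^ i) + 1 = (x + 1) ^ p" for p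
      by (induction p) (auto simp: algebra_simps)
    then show ?thesis unfolding S_def power_mult[of 2 "l * 2" q] x by simp
  qed
  ultimately have "(2 ^ l + 1) * (2 ^ l - 1) * S + 1 = (2::nat) ^ (l * 2 * q)"
    by (metis add_diff_cancel_right')
  then have e: "d * e + 1 = 2 ^ (l * 2 * q)"
    unfolding e_def by (metis dK1 mult.assoc)

  have cop: "coprime d (2 ^ r - 1)"
    using assms(4) coprime_Mersenne_add[OF _ e] unfolding n by blast
  define t where "t = Inv d r"
  obtain c where c: "d * t + c = c * 2 ^ r + 1" "2 \<le> c" "c < d"
    using Inv_quotient[OF _ cop d] r(1) unfolding t_def by (metis One_nat_def Suc_leI)
  have inv: "Inv d n = t * 2 ^ (l * 2 * q) + (c - 1) * e"
    unfolding n using Inv_add[OF _ c(1)[unfolded t_def] _ c(3) e] r(1) c(2) by (simp add: t_def)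

  have quot: "(real d * real t - 1) / (2 ^ r - 1) = real c"
  proof -
    have "real (d * t + c) = real (c * 2 ^ r + 1)" using c(1) by simp
    then have "real d * real t - 1 = real c * (2 ^ r - 1)" by (simp add: algebra_simps)
    moreover have "(2::real) ^ r - 1 \<noteq> 0" using one_less_power[of "2::real" r] r(1) by linarith
    ultimately show ?thesis by simp
  qed
  have e_real: "((2::real) ^ (n - r) - 1) / real d = real e"
  proof -
    have "real (d * e + 1) = 2 ^ (n - r)" unfolding e n by simp
    then have "(2::real) ^ (n - r) - 1 = real d * real e" by (simp add: algebra_simps)
    then show ?thesis using d by simp
  qed
  have a: "real (Inv d n) = real t * 2 ^ (n - r) + (real c - 1) * real e"
    using c(2) n unfolding inv by simp

  define v where "v = (c - 1) * (K + 1) - 1"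
  have "0 < (c - 1) * (K + 1)" using c(2) by simp
  then have v1: "v + 1 = (c - 1) * (K + 1)" by (simp add: v_def)
  have v: "v < 2 ^ l"
  proof -
    \<comment> \<open>The bound \<open>c \<le> d\<close> becomes \<open>v + K + 1 \<le> 2 ^ l\<close>.\<close>
    have "c * (K + 1) \<le> d * (K + 1)" using c(3) by (intro mult_right_mono) auto
    moreover have "c * (K + 1) = (c - 1) * (K + 1) + (K + 1)"
      using c(2) by (cases c) auto
    ultimately show ?thesis using v1 dK1 by linarith
  qed
  have v_real: "real v = (real c - 1) * (2 ^ k + 1) - 1"
  proof -
    have "real (v + 1) = real ((c - 1) * (K + 1))" using v1 by simp
    then have "real v + 1 = (real c - 1) * (2 ^ k + 1)" using c(2) by (simp add: K_def distrib_left)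
    then show ?thesis by linarith
  qed

  define B where "B = v * 2 ^ l + (2 ^ l - 1 - v)"
  have "B = (v + 1) * (2 ^ l - 1)"
  proof -
    obtain x where "(2::nat) ^ l = v + x + 1" using v
      by (metis less_natE Suc_eq_plus1)
    then show ?thesis by (simp add: B_def algebra_simps)
  qed
  then have BS: "(c - 1) * e = B * S" unfolding e_def v1 by (simp only: mult.assoc)
  \<comment> \<open>One period of the binary expansion, of value \<open>B\<close>.\<close>
  define w where "w = binseq l v @ complement (binseq l v)"
  have B: "binseq (l * 2) B = w"
    using binseq_append[of "2 ^ l - 1 - v" l l v] binseq_complement[OF v]
    unfolding w_def B_def by (simp add: mult_2_right)
  have "B < 2 ^ (l * 2)"
  proof -
    have "B < (v + 1) * 2 ^ l" using v by (simp add: B_def)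
    also have "\<dots> \<le> 2 ^ l * 2 ^ l" using v by (intro mult_right_mono) auto
    finally show ?thesis by (simp add: power_mult power2_eq_square)
  qed
  note BSq = binseq_geometric_sum[OF this, of q, folded S_def, unfolded B]
  have g: "binseq n (Inv d n) = binseq r t @ concat (replicate q w)"
    using BSq binseq_append[of "B * S" "l * 2 * q" r t] unfolding inv BS by (simp flip: n)
  have q': "(n - r) div (6 * k) = q" using q assms(2) by simp

  have "wt (binseq n (Inv d n)) = wt (binseq r t) + q * l"
    unfolding g w_def by (simp add: wt_append wt_concat_replicate wt_complement length_binseq)
  then have wt: "real (wt (binseq n (Inv d n))) = real (wt (binseq r t)) + (real n - real r) / 2"
    using n by simp

  show ?thesis
    unfolding t_def[symmetric] quot e_real q'
    using cop a v_real v g wt unfolding w_def l_def by blast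
qed

end
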